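(* Let $G$ be a connected graph with at least two vertices and maximum degree at least $3$, and let $g\in \mathrm{Aut}(Y(G))$. Then there are a unique $\sigma\in\mathrm{Aut}(G)$ and a unique $f\in\mathrm{Aut}(X(G))$ such that for all $uv\in E(G)$, $g(a(u,v))=f(a(\sigma(u),\sigma(v)))$ and $g(b(u,v))=f(b(\sigma(u),\sigma(v)))$. Moreover, $\mathrm{Aut}(Y(G))=\{f\circ\tau_\sigma : f\in\mathrm{Aut}(X(G)),\ \sigma\in\mathrm{Aut}(G)\}$.
   Context: All graphs are finite, simple and undirected. For a connected graph $G$ with at least two vertices: for each vertex $u$ of $G$ let $A(u)=\{a(u,v): uv\in E(G)\}$ and $B(u)=\{b(u,v): uv\in E(G)\}$ be sets of new pairwise distinct elements, and let $M(u)$ be the set of all subsets of $A(u)$ of even cardinality, each regarded as a new vertex (middle vertices). The gadget $Y(u)$ has vertex set $A(u)\cup B(u)\cup M(u)$ and, for $m\in M(u)$, the edge $\{a(u,v),m\}$ if $a(u,v)\in m$ and the edge $\{b(u,v),m\}$ if $a(u,v)\notin m$. The graph $Y(G)$ is the disjoint union of all gadgets $Y(u)$ together with, for each edge $uv\in E(G)$, the edges $\{a(u,v),a(v,u)\}$ and $\{b(u,v),b(v,u)\}$. The colored graph $X(G)$ is $Y(G)$ with a vertex coloring in which two vertices $x,y$ have the same color iff they lie in the same gadget $Y(u)$ and either $x=y$, or both are middle vertices, or $\{x,y\}=\{a(u,v),b(u,v)\}$ for some $v$; $\mathrm{Aut}(X(G))$ is the set of color-preserving automorphisms, viewed as a subset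 of $\mathrm{Aut}(Y(G))$. For $\sigma\in\mathrm{Aut}(G)$, $\tau_\sigma$ denotes the automorphism of $Y(G)$ given by $\tau_\sigma(a(u,v))=a(\sigma(u),\sigma(v))$, $\tau_\sigma(b(u,v))=b(\sigma(u),\sigma(v))$ for $uv\in E(G)$, and $\tau_\sigma(m)=\{a(\sigma(u),\sigma(w)) : a(u,w)\in m\}$ for $m\in M(u)$. *)

theory Defs
  imports Main "HOL-Combinatorics.Permutations"
begin

record 'a ugraph =
  verts :: "'a set"
  edges :: "'a set set"

definition simple_graph :: "'a ugraph \<Rightarrow> bool" where
  "simple_graph G \<longleftrightarrow> finite (verts G) \<and>
     (\<forall>e\<in>edges G. \<exists>u\<in>verts G. \<exists>v\<in>verts G. u \<noteq> v \<and> e = {u, v})"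

definition connected_graph :: "'a ugraph \<Rightarrow> bool" where
  "connected_graph G \<longleftrightarrow> verts G \<noteq> {} \<and>
     (\<forall>u\<in>verts G. \<forall>v\<in>verts G. (u, v) \<in> {(x, y). {x, y} \<in> edges G}\<^sup>*)"

definition degree :: "'a ugraph \<Rightarrow> 'a \<Rightarrow> nat" where
  "degree G u = card {v. {u, v} \<in> edges G}"

definition max_degree :: "'a ugraph \<Rightarrow> nat" where
  "max_degree G = Max (degree G ` verts G)"

text \<open>Automorphisms are total functions that are the identity outside the vertex set
  (this is part of \<^const>\<open>permutes\<close>), so that equality of
  functions is equality of automorphisms.\<close>

definition Aut :: "'a ugraph \<Rightarrow> ('a \<Rightarrow> 'a) set" where
  "Aut G = {f. f permutes verts G \<and>
     (\<forall>u\<in>verts G. \<forall>v\<in>verts G. {f u, f v} \<in> edges G \<longleftrightarrow> {u, v} \<in> edges G)}"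

text \<open>\<open>AV u v\<close> and \<open>BV u v\<close> are $a(u,v)$ and $b(u,v)$. In a middle vertex \<open>MV u m\<close> of the
  gadget at \<open>u\<close>, the subset of $A(u)$ is given by the set \<open>m\<close> of the pairs \<open>(u, v)\<close> with
  $a(u,v)$ in the subset; the tag \<open>u\<close> keeps the empty subsets of different gadgets apart.\<close>

datatype 'a yvert = AV 'a 'a | BV 'a 'a | MV 'a "('a \<times> 'a) set"

definition A_verts :: "'a ugraph \<Rightarrow> 'a \<Rightarrow> 'a yvert set" where
  "A_verts G u = {AV u v | v. {u, v} \<in> edges G}"

definition B_verts :: "'a ugraph \<Rightarrow> 'a \<Rightarrow> 'a yvert set" where
  "B_verts G u = {BV u v | v. {u, v} \<in> edges G}"

definition even_subsets :: "'a ugraph \<Rightarrow> 'a \<Rightarrow> ('a \<times> 'a) set set" where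
  "even_subsets G u = {m. m \<subseteq> {(u, v) | v. {u, v} \<in> edges G} \<and> even (card m)}"

definition M_verts :: "'a ugraph \<Rightarrow> 'a \<Rightarrow> 'a yvert set" where
  "M_verts G u = MV u ` even_subsets G u"

definition gadget :: "'a ugraph \<Rightarrow> 'a \<Rightarrow> 'a yvert ugraph" where
  "gadget G u = \<lparr>
     verts = A_verts G u \<union> B_verts G u \<union> M_verts G u,
     edges =
       {{AV u v, MV u m} | v m. {u, v} \<in> edges G \<and> m \<in> even_subsets G u \<and> (u, v) \<in> m} \<union>
       {{BV u v, MV u m} | v m. {u, v} \<in> edges G \<and> m \<in> even_subsets G u \<and> (u, v) \<notin> m}\<rparr>"

definition Y :: "'a ugraph \<Rightarrow> 'a yvert ugraph" where
  "Y G = \<lparr>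
     verts = (\<Union>u\<in>verts G. verts (gadget G u)),
     edges = (\<Union>u\<in>verts G. edges (gadget G u)) \<union>
       {{AV u v, AV v u} | u v. {u, v} \<in> edges G} \<union>
       {{BV u v, BV v u} | u v. {u, v} \<in> edges G}\<rparr>"

definition same_color :: "'a ugraph \<Rightarrow> 'a yvert \<Rightarrow> 'a yvert \<Rightarrow> bool" where
  "same_color G x y \<longleftrightarrow>
     (\<exists>u\<in>verts G. x \<in> verts (gadget G u) \<and> y \<in> verts (gadget G u) \<and>
       (x = y \<or>
        (x \<in> M_verts G u \<and> y \<in> M_verts G u) \<or>
        (\<exists>v. {u, v} \<in> edges G \<and> {x, y} = {AV u v, BV u v})))"

definition Aut_X :: "'a ugraph \<Rightarrow> ('a yvert \<Rightarrow> 'a yvert) set" where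
  "Aut_X G = {f \<in> Aut (Y G). \<forall>x\<in>verts (Y G). same_color G (f x) x}"

definition tau :: "'a ugraph \<Rightarrow> ('a \<Rightarrow> 'a) \<Rightarrow> 'a yvert \<Rightarrow> 'a yvert" where
  "tau G \<sigma> x =
     (if x \<in> verts (Y G) then
        (case x of
           AV u v \<Rightarrow> AV (\<sigma> u) (\<sigma> v)
         | BV u v \<Rightarrow> BV (\<sigma> u) (\<sigma> v)
         | MV u m \<Rightarrow> MV (\<sigma> u) {(\<sigma> u, \<sigma> w) | w. (u, w) \<in> m})
      else x)"

end

theory Submission imports Defs begin

text \<open>
  Every 6-cycle of \<open>Y(G)\<close> stays inside one gadget, and in a gadget of degree at least three
  every edge lies on a 6-cycle. Hence an automorphism \<open>g\<close> of \<open>Y(G)\<close> respects such a gadget. It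
  sends each pair \<open>a(u,v), b(u,v)\<close> to such a pair, because within the gadget only these have no
  common neighbour, and the opposite pair \<open>a(v,u), b(v,u)\<close>, reached by edges off all 6-cycles,
  to the opposite pair. Once \<open>g\<close> is controlled on one pair and its opposite, \<open>M(u)\<close> consists of
  the remaining neighbours of the pair, and the other pairs of the gadget lie in the neighbourhood
  of \<open>M(u)\<close>; so control spreads along the edges of \<open>G\<close>, and by connectedness \<open>g\<close> lies over some
  \<open>\<sigma> \<in> Aut(G)\<close>. Now \<open>\<tau>\<^sub>\<sigma>\<close> lies over \<open>\<sigma>\<close> too, the automorphisms over the identity are those of
  \<open>X(G)\<close>, and an automorphism of \<open>Y(G)\<close> is determined by its values on the \<open>a(u,v)\<close>, \<open>b(u,v)\<close>.
\<close>

lemma even_card_sym_diff: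
  assumes "finite A" "finite B"
  shows "even (card (sym_diff A B)) \<longleftrightarrow> even (card A) = even (card B)"
proof -
  have "card (sym_diff A B) = card (A - B) + card (B - A)"
    using assms by (intro card_Un_disjoint) auto
  moreover have "card A = card (A - B) + card (A \<inter> B)"
    using card_Int_Diff[OF assms(1), of B] by simp
  moreover have "card B = card (B - A) + card (A \<inter> B)"
    using card_Int_Diff[OF assms(2), of A] by (simp add: Int_commute)
  ultimately show ?thesis by presburger
qed

section \<open>Automorphisms of finite simple graphs\<close>

definition neighbours :: "'a ugraph \<Rightarrow> 'a set \<Rightarrow> 'a set" where
  "neighbours H S = {y. \<exists>x\<in>S. {x, y} \<in> edges H}"

lemma simple_graph_edgeD:
  assumes "simple_graph H" "{x, y} \<in> edges H"
  shows "x \<in> verts H" "y \<in> verts H" "x \<noteq> y"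
  using assms unfolding simple_graph_def by (metis doubleton_eq_iff)+

lemma simple_graph_edges_subset_Pow: "simple_graph H \<Longrightarrow> edges H \<subseteq> Pow (verts H)"
  by (auto simp: simple_graph_def)

lemma obtain_neighbour_outside:
  assumes "finite S" "card S < degree H u"
  obtains v where "{u, v} \<in> edges H" "v \<notin> S"
proof -
  have "\<not> {v. {u, v} \<in> edges H} \<subseteq> S"
    using assms card_mono[of S "{v. {u, v} \<in> edges H}"] by (auto simp: degree_def)
  then show ?thesis using that by blast
qed

lemma obtain_two_more_neighbours:
  assumes "3 \<le> degree H u"
  obtains j k where "{u, j} \<in> edges H" "{u, k} \<in> edges H" "j \<noteq> i" "k \<noteq> i" "k \<noteq> j"
proof -
  obtain j where j: "{u, j} \<in> edges H" "j \<noteq> i"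
    using assms obtain_neighbour_outside[of "{i}" H u] by auto
  moreover obtain k where "{u, k} \<in> edges H" "k \<noteq> i" "k \<noteq> j"
    using assms j obtain_neighbour_outside[of "{i, j}" H u] by auto
  ultimately show ?thesis using that by blast
qed

lemma obtain_max_degree:
  assumes "finite (verts H)" "verts H \<noteq> {}"
  obtains u where "u \<in> verts H" "degree H u = max_degree H"
proof -
  have "max_degree H \<in> degree H ` verts H"
    unfolding max_degree_def using assms by (intro Max_in) auto
  then show ?thesis using that by auto
qed

lemma connected_graph_obtain_neighbour:
  assumes "connected_graph H" "card (verts H) \<ge> 2" "u \<in> verts H"
  obtains v where "{u, v} \<in> edges H"
proof -
  have "\<not> verts H \<subseteq> {u}"
    using assms(2) card_mono[of "{u}" "verts H"] by auto
  then obtain v where v: "v \<in> verts H" "v \<noteq> u" by blast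
  then have "(u, v) \<in> {(x, y). {x, y} \<in> edges H}\<^sup>*"
    using assms by (simp add: connected_graph_def)
  then show ?thesis using v that by (auto elim: converse_rtranclE)
qed

lemma Aut_permutes: "f \<in> Aut H \<Longrightarrow> f permutes verts H"
  by (simp add: Aut_def)

lemma Aut_bij: "f \<in> Aut H \<Longrightarrow> bij f"
  by (rule permutes_bij[OF Aut_permutes])

lemma Aut_inj: "f \<in> Aut H \<Longrightarrow> inj f"
  by (rule bij_is_inj[OF Aut_bij])

lemma Aut_in_verts_iff: "f \<in> Aut H \<Longrightarrow> f x \<in> verts H \<longleftrightarrow> x \<in> verts H"
  by (rule permutes_in_image[OF Aut_permutes])

lemma Aut_edge_iff:
  assumes "simple_graph H" "f \<in> Aut H"
  shows "{f x, f y} \<in> edges H \<longleftrightarrow> {x, y} \<in> edges H"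
proof (cases "x \<in> verts H \<and> y \<in> verts H")
  case True
  then show ?thesis using assms(2) by (simp add: Aut_def)
next
  case False
  then show ?thesis
    using simple_graph_edgeD(1,2)[OF assms(1)] Aut_in_verts_iff[OF assms(2)] by metis
qed

lemma Aut_comp:
  assumes "f \<in> Aut H" "g \<in> Aut H" shows "f \<circ> g \<in> Aut H"
  using assms by (auto simp: Aut_def permutes_compose permutes_in_image)

lemma Aut_inv:
  assumes "f \<in> Aut H" shows "inv f \<in> Aut H"
proof -
  note perm = Aut_permutes[OF assms]
  have "{inv f x, inv f y} \<in> edges H \<longleftrightarrow> {x, y} \<in> edges H"
    if "x \<in> verts H" "y \<in> verts H" for x y
  proof -
    have "inv f x \<in> verts H" "inv f y \<in> verts H"
      using that by (simp_all add: permutes_in_image[OF permutes_inv[OF perm]])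
    then have "{f (inv f x), f (inv f y)} \<in> edges H \<longleftrightarrow> {inv f x, inv f y} \<in> edges H"
      using assms by (simp add: Aut_def)
    then show ?thesis by (simp add: permutes_inverses(1)[OF perm])
  qed
  then show ?thesis using permutes_inv[OF perm] by (simp add: Aut_def)
qed

lemma AutI_injective_endomorphism:
  assumes H: "simple_graph H"
    and into: "f ` verts H \<subseteq> verts H" and inj: "inj_on f (verts H)"
    and outside: "\<And>x. x \<notin> verts H \<Longrightarrow> f x = x"
    and hom: "\<And>x y. {x, y} \<in> edges H \<Longrightarrow> {f x, f y} \<in> edges H"
  shows "f \<in> Aut H"
proof -
  have fin: "finite (verts H)" using H by (simp add: simple_graph_def)
  have perm: "f permutes verts H"
    using into inj outside fin by (intro inj_imp_permutes) auto
  have image_inj: "inj_on ((`) f) (edges H)"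
    using permutes_inj[OF perm] by (auto simp: inj_on_def inj_image_eq_iff)
  have "f ` e \<in> edges H" if e: "e \<in> edges H" for e
  proof -
    obtain x y where xy: "e = {x, y}" using H e by (auto simp: simple_graph_def)
    show ?thesis using hom[of x y] e unfolding xy by simp
  qed
  then have "(`) f ` edges H \<subseteq> edges H" by blast
  moreover have "finite (edges H)"
    using simple_graph_edges_subset_Pow[OF H] fin by (meson finite_Pow_iff finite_subset)
  ultimately have image_edges: "(`) f ` edges H = edges H"
    using image_inj by (simp add: endo_inj_surj)
  have "{x, y} \<in> edges H" if "{f x, f y} \<in> edges H" for x y
  proof -
    have "f ` {x, y} \<in> (`) f ` edges H" using that image_edges by simp
    then show ?thesis using permutes_inj[OF perm] by (auto simp only: inj_image_eq_iff)
  qed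
  with perm hom show ?thesis unfolding Aut_def by blast
qed

lemma neighbours_Aut_image:
  assumes "simple_graph H" "f \<in> Aut H"
  shows "neighbours H (f ` S) = f ` neighbours H S"
proof
  show "neighbours H (f ` S) \<subseteq> f ` neighbours H S"
  proof
    fix y assume "y \<in> neighbours H (f ` S)"
    then obtain x where x: "x \<in> S" "{f x, y} \<in> edges H" by (auto simp: neighbours_def)
    obtain z where z: "y = f z" using bij_is_surj[OF Aut_bij[OF assms(2)]] by (rule surjE)
    with x show "y \<in> f ` neighbours H S"
      by (auto simp: neighbours_def Aut_edge_iff[OF assms])
  qed
qed (auto simp: neighbours_def Aut_edge_iff[OF assms])

lemma degree_eq_card_neighbours: "degree H u = card (neighbours H {u})"
  by (simp add: degree_def neighbours_def)

lemma degree_Aut: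
  assumes "simple_graph H" "f \<in> Aut H"
  shows "degree H (f u) = degree H u"
proof -
  have "neighbours H {f u} = f ` neighbours H {u}"
    using neighbours_Aut_image[OF assms, of "{u}"] by simp
  then show ?thesis
    by (simp add: degree_eq_card_neighbours card_image inj_on_subset[OF Aut_inj[OF assms(2)]])
qed

definition on_hexagon :: "'a ugraph \<Rightarrow> 'a \<Rightarrow> 'a \<Rightarrow> bool" where
  "on_hexagon H x y \<longleftrightarrow> (\<exists>p q r s. distinct [x, y, p, q, r, s] \<and>
     {{x, y}, {y, p}, {p, q}, {q, r}, {r, s}, {s, x}} \<subseteq> edges H)"

lemma on_hexagonI:
  assumes "distinct [x, y, p, q, r, s]"
    and "{{x, y}, {y, p}, {p, q}, {q, r}, {r, s}, {s, x}} \<subseteq> edges H"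
  shows "on_hexagon H x y"
  unfolding on_hexagon_def using assms by (intro exI conjI)

lemma on_hexagon_image:
  assumes H: "simple_graph H" and f: "f \<in> Aut H" and "on_hexagon H x y"
  shows "on_hexagon H (f x) (f y)"
proof -
  from assms(3) obtain p q r s where "distinct [x, y, p, q, r, s]"
    "{{x, y}, {y, p}, {p, q}, {q, r}, {r, s}, {s, x}} \<subseteq> edges H"
    unfolding on_hexagon_def by (elim exE conjE)
  then show ?thesis
    by (intro on_hexagonI[of _ _ "f p" "f q" "f r" "f s"])
      (simp_all add: Aut_edge_iff[OF H f] inj_eq[OF Aut_inj[OF f]])
qed

lemma on_hexagon_Aut_iff:
  assumes "simple_graph H" "f \<in> Aut H"
  shows "on_hexagon H (f x) (f y) \<longleftrightarrow> on_hexagon H x y"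
  using on_hexagon_image[OF assms]
    on_hexagon_image[OF assms(1) Aut_inv[OF assms(2)], of "f x" "f y"]
  by (auto simp: inv_f_f[OF Aut_inj[OF assms(2)]])

section \<open>The graph \<open>Y(G)\<close>\<close>

definition terminal :: "bool \<Rightarrow> 'a \<Rightarrow> 'a \<Rightarrow> 'a yvert" where
  "terminal s u v = (if s then AV u v else BV u v)"

definition terminals :: "'a \<Rightarrow> 'a \<Rightarrow> 'a yvert set" where
  "terminals u v = {AV u v, BV u v}"

fun owner :: "'a yvert \<Rightarrow> 'a" where
  "owner (AV u v) = u"
| "owner (BV u v) = u"
| "owner (MV u m) = u"

lemma AV_eq_terminal: "AV u v = terminal True u v"
  and BV_eq_terminal: "BV u v = terminal False u v"
  by (simp_all add: terminal_def)

lemma terminal_eq_iff [simp]: "terminal s u v = terminal t u' v' \<longleftrightarrow> s = t \<and> u = u' \<and> v = v'"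
  by (auto simp: terminal_def)

lemma terminal_neq_MV [simp]: "terminal s u v \<noteq> MV w m" "MV w m \<noteq> terminal s u v"
  by (auto simp: terminal_def)

lemma owner_terminal [simp]: "owner (terminal s u v) = u"
  by (simp add: terminal_def)

lemma yvert_terminal_cases:
  obtains (terminal) s u v where "x = terminal s u v" | (middle) u m where "x = MV u m"
  by (cases x) (auto simp: AV_eq_terminal BV_eq_terminal)

lemma terminals_eq_range: "terminals u v = range (\<lambda>s. terminal s u v)"
  by (auto simp: terminals_def terminal_def)

lemma mem_terminals_iff: "x \<in> terminals u v \<longleftrightarrow> (\<exists>s. x = terminal s u v)"
  by (auto simp: terminals_eq_range)

lemma terminal_in_terminals [simp]: "terminal s u v \<in> terminals u' v' \<longleftrightarrow> u = u' \<and> v = v'"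
  by (auto simp: mem_terminals_iff)

lemma MV_notin_terminals [simp]: "MV w m \<notin> terminals u v"
  by (auto simp: mem_terminals_iff)

lemma terminals_disjoint_M_verts: "terminals u v \<inter> M_verts G w = {}"
  by (auto simp: M_verts_def)

lemma empty_in_even_subsets [simp]: "{} \<in> even_subsets G u"
  by (simp add: even_subsets_def)

lemma M_verts_eq_iff [simp]: "M_verts G u = M_verts G v \<longleftrightarrow> u = v"
proof
  assume "M_verts G u = M_verts G v"
  moreover have "MV u {} \<in> M_verts G u" by (simp add: M_verts_def)
  ultimately have "MV u {} \<in> M_verts G v" by simp
  then show "u = v" by (auto simp: M_verts_def)
qed simp

locale gadget_graph =
  fixes G :: "'a ugraph"
  assumes simple: "simple_graph G"
begin

abbreviation E :: "'a \<Rightarrow> 'a \<Rightarrow> bool" where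
  "E u v \<equiv> {u, v} \<in> edges G"

abbreviation adj :: "'a yvert \<Rightarrow> 'a yvert \<Rightarrow> bool" where
  "adj x y \<equiv> {x, y} \<in> edges (Y G)"

lemma edge_sym: "E u v \<Longrightarrow> E v u"
  by (simp add: insert_commute)

lemmas edgeD = simple_graph_edgeD[OF simple]

lemma finite_verts: "finite (verts G)"
  using simple by (simp add: simple_graph_def)

lemma finite_adjacent: "finite {v. E u v}"
  by (rule finite_subset[OF _ finite_verts]) (auto dest: edgeD)

subsection \<open>Vertices and edges\<close>

lemma even_subsets_subset: "even_subsets G u \<subseteq> Pow ({u} \<times> {v. E u v})"
  by (auto simp: even_subsets_def)

lemma even_subsetsD:
  assumes "m \<in> even_subsets G u" "(x, v) \<in> m" shows "x = u" "E u v"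
  using assms even_subsets_subset by blast+

lemma even_subsets_eqI:
  assumes "m \<in> even_subsets G u" "n \<in> even_subsets G u"
    and "\<And>w. E u w \<Longrightarrow> (u, w) \<in> m \<longleftrightarrow> (u, w) \<in> n"
  shows "m = n"
proof -
  have "(x, w) \<in> m \<longleftrightarrow> (x, w) \<in> n" for x w
    using assms(3) even_subsetsD[OF assms(1)] even_subsetsD[OF assms(2)] by blast
  then show ?thesis by auto
qed

lemma terminal_in_gadget: "terminal s u v \<in> verts (gadget G x) \<longleftrightarrow> x = u \<and> E u v"
  by (auto simp: gadget_def terminal_def A_verts_def B_verts_def M_verts_def)

lemma MV_in_gadget: "MV u m \<in> verts (gadget G x) \<longleftrightarrow> x = u \<and> m \<in> even_subsets G u"
  by (auto simp: gadget_def A_verts_def B_verts_def M_verts_def)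

lemma terminal_in_Y [simp]: "terminal s u v \<in> verts (Y G) \<longleftrightarrow> E u v"
  by (auto simp: Y_def terminal_in_gadget dest: edgeD)

lemma MV_in_Y [simp]: "MV u m \<in> verts (Y G) \<longleftrightarrow> u \<in> verts G \<and> m \<in> even_subsets G u"
  by (auto simp: Y_def MV_in_gadget)

lemma Y_vertex_cases:
  assumes "x \<in> verts (Y G)"
  obtains (terminal) s u v where "x = terminal s u v" "E u v"
    | (middle) u m where "x = MV u m" "u \<in> verts G" "m \<in> even_subsets G u"
  using assms by (cases x rule: yvert_terminal_cases) auto

lemma adj_terminal_terminal [simp]:
  "adj (terminal s u v) (terminal t u' v') \<longleftrightarrow> s = t \<and> u' = v \<and> v' = u \<and> E u v"
  by (auto simp: Y_def gadget_def terminal_def doubleton_eq_iff insert_commute)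

lemma adj_terminal_MV [simp]:
  "adj (terminal s u v) (MV u' m) \<longleftrightarrow> u' = u \<and> E u v \<and> m \<in> even_subsets G u \<and> ((u, v) \<in> m) = s"
  using edgeD(1)[of u v]
  by (auto simp: Y_def gadget_def terminal_def doubleton_eq_iff insert_commute)

lemma adj_MV_terminal [simp]:
  "adj (MV u' m) (terminal s u v) \<longleftrightarrow> u' = u \<and> E u v \<and> m \<in> even_subsets G u \<and> ((u, v) \<in> m) = s"
  by (subst insert_commute) (rule adj_terminal_MV)

lemma adj_MV_MV [simp]: "\<not> adj (MV u m) (MV u' m')"
  by (auto simp: Y_def gadget_def doubleton_eq_iff)

lemma adj_terminal_cases:
  assumes "adj (terminal s u v) y"
  obtains (crossing) "y = terminal s v u" "E u v"
    | (middle) m where "y = MV u m" "E u v" "m \<in> even_subsets G u" "((u, v) \<in> m) = s"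
  using assms by (cases y rule: yvert_terminal_cases) auto

lemma adj_MV_cases:
  assumes "adj (MV u m) y"
  obtains w where "y = terminal ((u, w) \<in> m) u w" "E u w" "m \<in> even_subsets G u"
  using assms by (cases y rule: yvert_terminal_cases) auto

lemma simple_graph_Y: "simple_graph (Y G)"
  unfolding simple_graph_def
proof (intro conjI ballI)
  have "finite (even_subsets G u)" for u
    by (rule finite_subset[OF even_subsets_subset]) (simp add: finite_adjacent)
  then show "finite (verts (Y G))"
    using finite_verts finite_adjacent
    by (simp add: Y_def gadget_def A_verts_def B_verts_def M_verts_def)
next
  fix e assume e: "e \<in> edges (Y G)"
  then obtain x y where xy: "e = {x, y}" by (auto simp: Y_def gadget_def)
  have "x \<in> verts (Y G) \<and> x \<noteq> y" if "adj x y" for x y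
    using that
    by (cases x rule: yvert_terminal_cases; cases y rule: yvert_terminal_cases)
      (auto dest: edgeD)
  moreover have "adj x y" "adj y x" using e unfolding xy by (simp_all only: insert_commute)
  ultimately have "x \<in> verts (Y G)" "y \<in> verts (Y G)" "x \<noteq> y" by blast+
  then show "\<exists>x\<in>verts (Y G). \<exists>y\<in>verts (Y G). x \<noteq> y \<and> e = {x, y}" using xy by blast
qed

subsection \<open>Even subsets with prescribed elements\<close>

lemma finite_even_subset: "m \<in> even_subsets G u \<Longrightarrow> finite m"
  using even_subsets_subset
  by (blast intro: finite_subset[OF _ finite_cartesian_product[OF _ finite_adjacent]])

lemma sym_diff_in_even_subsets:
  assumes m: "m \<in> even_subsets G u" and n: "n \<in> even_subsets G u"
  shows "sym_diff m n \<in> even_subsets G u"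
proof -
  have "even (card m)" "even (card n)"
    using m n by (simp_all only: even_subsets_def mem_Collect_eq)
  then have "even (card (sym_diff m n))"
    using even_card_sym_diff[OF finite_even_subset[OF m] finite_even_subset[OF n]] by blast
  with m n show ?thesis unfolding even_subsets_def by blast
qed

lemma doubleton_in_even_subsets:
  assumes "E u i" "E u j" "i \<noteq> j"
  shows "{(u, i), (u, j)} \<in> even_subsets G u"
  using assms by (auto simp: even_subsets_def)

lemma even_subset_with_value:
  assumes "E u i" "E u j" "i \<noteq> j"
  obtains m where "m \<in> even_subsets G u" "((u, i) \<in> m) = s"
  using that[of "{}"] that[OF doubleton_in_even_subsets[OF assms]] by (cases s) auto

lemma even_subset_with_two_values:
  assumes "E u i" "E u j" "E u k" "i \<noteq> j" "i \<noteq> k" "j \<noteq> k"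
  obtains m where "m \<in> even_subsets G u" "((u, i) \<in> m) = s" "((u, j) \<in> m) = t"
proof -
  let ?m = "if s then if t then {(u, i), (u, j)} else {(u, i), (u, k)}
    else if t then {(u, j), (u, k)} else {}"
  have "?m \<in> even_subsets G u" using assms by (simp add: doubleton_in_even_subsets)
  moreover have "((u, i) \<in> ?m) = s" "((u, j) \<in> ?m) = t" using assms by auto
  ultimately show ?thesis by (rule that)
qed

subsection \<open>Neighbourhoods\<close>

lemma neighbours_MV:
  assumes "m \<in> even_subsets G u"
  shows "neighbours (Y G) {MV u m} = (\<lambda>w. terminal ((u, w) \<in> m) u w) ` {w. E u w}"
  using assms by (auto simp: neighbours_def elim!: adj_MV_cases)

lemma degree_MV:
  assumes "m \<in> even_subsets G u" shows "degree (Y G) (MV u m) = degree G u"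
proof -
  have "inj_on (\<lambda>w. terminal ((u, w) \<in> m) u w) {w. E u w}" by (auto simp: inj_on_def)
  then show ?thesis
    by (simp add: degree_eq_card_neighbours neighbours_MV[OF assms] card_image)
       (simp add: neighbours_def)
qed

lemma neighbours_terminals:
  assumes "E u v" shows "neighbours (Y G) (terminals u v) = terminals v u \<union> M_verts G u"
  using assms
  by (force simp: neighbours_def mem_terminals_iff M_verts_def elim!: adj_terminal_cases)

lemma M_verts_eq_neighbours:
  assumes "E u v" shows "M_verts G u = neighbours (Y G) (terminals u v) - terminals v u"
  using neighbours_terminals[OF assms] terminals_disjoint_M_verts[of v u G u] by blast

lemma opposite_terminals_eq_neighbours:
  assumes "E u v" shows "terminals v u = neighbours (Y G) (terminals u v) - M_verts G u"
  using neighbours_terminals[OF assms] terminals_disjoint_M_verts[of v u G u] by blast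

lemma neighbours_M_verts_subset:
  "neighbours (Y G) (M_verts G u) \<subseteq> (\<Union>w\<in>{w. E u w}. terminals u w)"
  by (auto simp: neighbours_def M_verts_def elim!: adj_MV_cases)

lemma neighbours_M_verts:
  assumes "E u i" "E u j" "i \<noteq> j"
  shows "neighbours (Y G) (M_verts G u) = (\<Union>w\<in>{w. E u w}. terminals u w)"
proof (rule equalityI[OF neighbours_M_verts_subset])
  have "terminal s u w \<in> neighbours (Y G) (M_verts G u)" if w: "E u w" for s w
  proof -
    obtain k where "E u k" "w \<noteq> k" using assms by metis
    then obtain m where "m \<in> even_subsets G u" "((u, w) \<in> m) = s"
      using even_subset_with_value[OF w] by metis
    then show ?thesis using w by (auto simp: neighbours_def M_verts_def)
  qed
  then show "(\<Union>w\<in>{w. E u w}. terminals u w) \<subseteq> neighbours (Y G) (M_verts G u)"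
    by (auto simp: mem_terminals_iff)
qed

lemma no_common_neighbour_AV_BV:
  "neighbours (Y G) {AV u v} \<inter> neighbours (Y G) {BV u v} = {}"
  by (auto simp: neighbours_def AV_eq_terminal BV_eq_terminal elim!: adj_terminal_cases)

text \<open>The third index \<open>k\<close> is indispensable: in a gadget of degree two, \<open>a(u,i)\<close> and \<open>b(u,j)\<close> with
  \<open>i \<noteq> j\<close> have no common neighbour either.\<close>

lemma terminals_eqI:
  assumes x: "x \<in> terminals u i" and y: "y \<in> terminals u j"
    and E: "E u i" "E u j" "E u k" and k: "k \<noteq> i" "k \<noteq> j"
    and "x \<noteq> y" and disjoint: "neighbours (Y G) {x} \<inter> neighbours (Y G) {y} = {}"
  shows "{x, y} = terminals u i"
proof -
  obtain s t where st: "x = terminal s u i" "y = terminal t u j"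
    using x y by (auto simp: mem_terminals_iff)
  have "i = j"
  proof (rule ccontr)
    assume "i \<noteq> j"
    then obtain m where "m \<in> even_subsets G u" "((u, i) \<in> m) = s" "((u, j) \<in> m) = t"
      using even_subset_with_two_values[OF E] k by metis
    then have "MV u m \<in> neighbours (Y G) {x} \<inter> neighbours (Y G) {y}"
      using E by (simp add: st neighbours_def)
    with disjoint show False by blast
  qed
  with \<open>x \<noteq> y\<close> show ?thesis
    unfolding st terminals_def by (cases s; cases t) (auto simp: terminal_def)
qed

subsection \<open>Hexagons\<close>

lemma owner_eq_if_on_hexagon:
  assumes "on_hexagon (Y G) x y" shows "owner x = owner y"
proof (rule ccontr)
  assume ne: "owner x \<noteq> owner y"
  obtain p q r s where distinct: "distinct [x, y, p, q, r, s]"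
    and hex: "adj x y" "adj y p" "adj p q" "adj q r" "adj r s" "adj s x"
    using assms unfolding on_hexagon_def insert_subset by meson
  obtain b u v where x: "x = terminal b u v"
    using hex(1) ne by (cases x rule: yvert_terminal_cases) (auto elim: adj_MV_cases)
  then have y: "y = terminal b v u" "E u v"
    using hex(1) ne by (auto elim: adj_terminal_cases)
  obtain m where m: "p = MV v m" "((v, u) \<in> m) = b"
    using hex(2) distinct x y by (auto elim: adj_terminal_cases)
  obtain n where n: "s = MV u n"
    using hex(6) distinct x y by (auto simp: insert_commute[of s] elim: adj_terminal_cases)
  obtain w where w: "q = terminal ((v, w) \<in> m) v w" using hex(3) m by (auto elim: adj_MV_cases)
  obtain w' where "r = terminal ((u, w') \<in> n) u w'"
    using hex(5) n by (auto simp: insert_commute[of r] elim: adj_MV_cases)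
  with hex(4) w have "w = u" by simp
  with w m y distinct show False by simp
qed

lemma on_hexagon_terminal_MV:
  assumes "3 \<le> degree G u" and m: "m \<in> even_subsets G u" and i: "E u i"
  shows "on_hexagon (Y G) (terminal ((u, i) \<in> m) u i) (MV u m)"
proof -
  obtain j k where j: "E u j" "j \<noteq> i" and k: "E u k" "k \<noteq> i" "k \<noteq> j"
    using obtain_two_more_neighbours[OF assms(1), of i] by blast
  define m\<^sub>i m\<^sub>j where "m\<^sub>i = sym_diff m {(u, i), (u, k)}"
    and "m\<^sub>j = sym_diff m {(u, j), (u, k)}"
  have in_even: "m\<^sub>i \<in> even_subsets G u" "m\<^sub>j \<in> even_subsets G u"
    unfolding m\<^sub>i_def m\<^sub>j_def
    using i j k by (intro sym_diff_in_even_subsets[OF m] doubleton_in_even_subsets; simp)+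
  have membership:
    "(u, i) \<in> m\<^sub>i \<longleftrightarrow> (u, i) \<notin> m" "(u, i) \<in> m\<^sub>j \<longleftrightarrow> (u, i) \<in> m"
    "(u, j) \<in> m\<^sub>i \<longleftrightarrow> (u, j) \<in> m" "(u, j) \<in> m\<^sub>j \<longleftrightarrow> (u, j) \<notin> m"
    "(u, k) \<in> m\<^sub>i \<longleftrightarrow> (u, k) \<notin> m" "(u, k) \<in> m\<^sub>j \<longleftrightarrow> (u, k) \<notin> m"
    unfolding m\<^sub>i_def m\<^sub>j_def using j k by auto
  have "m \<noteq> m\<^sub>i" "m \<noteq> m\<^sub>j" "m\<^sub>i \<noteq> m\<^sub>j" using membership by blast+
  then show ?thesis
    using i j k m in_even membership
    by (intro on_hexagonI[of _ _ "terminal ((u, j) \<in> m) u j" "MV u m\<^sub>i"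
          "terminal ((u, k) \<notin> m) u k" "MV u m\<^sub>j"]) simp_all
qed

end

section \<open>Automorphisms of \<open>Y(G)\<close> permute the gadgets\<close>

definition maps_gadget :: "'a ugraph \<Rightarrow> ('a yvert \<Rightarrow> 'a yvert) \<Rightarrow> 'a \<Rightarrow> 'a \<Rightarrow> bool" where
  "maps_gadget G g u u' \<longleftrightarrow> g ` M_verts G u = M_verts G u' \<and>
     (\<forall>v. {u, v} \<in> edges G \<longrightarrow> (\<exists>v'. {u', v'} \<in> edges G \<and> g ` terminals u v = terminals u' v'))"

definition lies_over :: "'a ugraph \<Rightarrow> ('a yvert \<Rightarrow> 'a yvert) \<Rightarrow> ('a \<Rightarrow> 'a) \<Rightarrow> bool" where
  "lies_over G g \<sigma> \<longleftrightarrow> (\<forall>u\<in>verts G. g ` M_verts G u = M_verts G (\<sigma> u)) \<and>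
     (\<forall>u v. {u, v} \<in> edges G \<longrightarrow> g ` terminals u v = terminals (\<sigma> u) (\<sigma> v))"

locale gadget_graph_Aut = gadget_graph +
  fixes g :: "'a yvert \<Rightarrow> 'a yvert"
  assumes g: "g \<in> Aut (Y G)"
begin

lemmas g_adj [simp] = Aut_edge_iff[OF simple_graph_Y g]

lemmas g_eq_iff [simp] = inj_eq[OF Aut_inj[OF g]]

lemmas image_neighbours = neighbours_Aut_image[OF simple_graph_Y g, symmetric]

lemmas image_diff = image_set_diff[OF Aut_inj[OF g]]

lemma on_hexagon_g [simp]: "on_hexagon (Y G) (g x) (g y) \<longleftrightarrow> on_hexagon (Y G) x y"
  by (rule on_hexagon_Aut_iff[OF simple_graph_Y g])

subsection \<open>From one pair of terminals to the whole gadget\<close>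

lemma image_terminals_eqI:
  assumes "g (AV u v) \<in> terminals u' i" "g (BV u v) \<in> terminals u' j"
    and "E u' i" "E u' j" "E u' k" "k \<noteq> i" "k \<noteq> j"
  shows "g ` terminals u v = terminals u' i"
proof -
  have "neighbours (Y G) {g (AV u v)} \<inter> neighbours (Y G) {g (BV u v)}
      = g ` neighbours (Y G) {AV u v} \<inter> g ` neighbours (Y G) {BV u v}"
    by (simp add: image_neighbours)
  also have "\<dots> = {}"
    using no_common_neighbour_AV_BV[of u v]
    by (simp add: image_Int[OF Aut_inj[OF g], symmetric])
  finally have "{g (AV u v), g (BV u v)} = terminals u' i"
    by (intro terminals_eqI[OF assms]) simp_all
  then show ?thesis by (simp add: terminals_def)
qed

lemma image_M_verts:
  assumes "E u v" "E u' v'"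
    and "g ` terminals u v = terminals u' v'" "g ` terminals v u = terminals v' u'"
  shows "g ` M_verts G u = M_verts G u'"
  using assms by (simp add: M_verts_eq_neighbours[of _ v] M_verts_eq_neighbours[of _ v']
      image_diff image_neighbours)

lemma image_opposite_terminals:
  assumes "E u v" "E u' v'"
    and "g ` terminals u v = terminals u' v'" "g ` M_verts G u = M_verts G u'"
  shows "g ` terminals v u = terminals v' u'"
  using assms by (simp add: opposite_terminals_eq_neighbours image_diff image_neighbours)

lemma image_other_terminals:
  assumes uv: "E u v" "E u' v'"
    and image: "g ` terminals u v = terminals u' v'" "g ` M_verts G u = M_verts G u'"
    and w: "E u w" "w \<noteq> v"
  shows "\<exists>w'. E u' w' \<and> g ` terminals u w = terminals u' w'"
proof -
  have other: "\<exists>w'. E u' w' \<and> v' \<noteq> w' \<and> g x \<in> terminals u' w'" if x: "x \<in> terminals u w" for x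
  proof -
    have "x \<in> neighbours (Y G) (M_verts G u)"
      using x w by (auto simp: neighbours_M_verts[OF w(1) uv(1) w(2)])
    then have "g x \<in> neighbours (Y G) (M_verts G u')"
      using image_neighbours[of "M_verts G u"] by (auto simp: image(2)[symmetric])
    then obtain w' where "E u' w'" "g x \<in> terminals u' w'"
      using neighbours_M_verts_subset[of u'] by blast
    moreover have "g x \<notin> terminals u' v'"
      using x w by (auto simp: image(1)[symmetric] mem_terminals_iff)
    ultimately show ?thesis by auto
  qed
  obtain i where i: "E u' i" "v' \<noteq> i" "g (AV u w) \<in> terminals u' i"
    using other[of "AV u w"] by (auto simp: terminals_def)
  obtain j where j: "E u' j" "v' \<noteq> j" "g (BV u w) \<in> terminals u' j"
    using other[of "BV u w"] by (auto simp: terminals_def)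
  show ?thesis using image_terminals_eqI[OF i(3) j(3) i(1) j(1) uv(2) i(2) j(2)] i(1) by blast
qed

lemma maps_gadgetI:
  assumes "E u v" "E u' v'"
    and image: "g ` terminals u v = terminals u' v'" "g ` terminals v u = terminals v' u'"
  shows "maps_gadget G g u u'"
proof -
  have middle: "g ` M_verts G u = M_verts G u'" by (rule image_M_verts[OF assms])
  have "\<exists>w'. E u' w' \<and> g ` terminals u w = terminals u' w'" if "E u w" for w
    using image_other_terminals[OF assms(1-3) middle that] assms(2,3) by (cases "w = v") auto
  with middle show ?thesis by (simp add: maps_gadget_def)
qed

lemma maps_gadget_neighbour:
  assumes "maps_gadget G g u u'" and uv: "E u v"
  obtains v' where "E u' v'" "g ` terminals u v = terminals u' v'" "maps_gadget G g v v'"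
proof -
  have middle: "g ` M_verts G u = M_verts G u'" using assms by (simp add: maps_gadget_def)
  obtain v' where v': "E u' v'" "g ` terminals u v = terminals u' v'"
    using assms unfolding maps_gadget_def by blast
  have "g ` terminals v u = terminals v' u'"
    by (rule image_opposite_terminals[OF uv v' middle])
  with v' have "maps_gadget G g v v'" using uv by (intro maps_gadgetI) (auto dest: edge_sym)
  with v' show ?thesis by (rule that)
qed

subsection \<open>Gadgets of degree at least three\<close>

lemma owner_image_eq:
  assumes "3 \<le> degree G u" "m \<in> even_subsets G u" "E u i"
  shows "owner (g (terminal ((u, i) \<in> m) u i)) = owner (g (MV u m))"
  using on_hexagon_terminal_MV[OF assms] by (intro owner_eq_if_on_hexagon) simp

lemma image_middle:
  assumes u: "3 \<le> degree G u" and m: "m \<in> even_subsets G u"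
  obtains u' m' where "g (MV u m) = MV u' m'" "m' \<in> even_subsets G u'" "3 \<le> degree G u'"
proof -
  obtain i where i: "E u i" using obtain_neighbour_outside[of "{}" G u] u by auto
  then have "adj (terminal ((u, i) \<in> m) u i) (MV u m)" using m by simp
  then have adj: "adj (g (MV u m)) (g (terminal ((u, i) \<in> m) u i))"
    by (simp only: g_adj insert_commute)
  show ?thesis
  proof (cases "g (MV u m)" rule: yvert_terminal_cases)
    \<comment> \<open>Impossible: every edge at \<open>MV u m\<close> lies on a 6-cycle, but a terminal has a crossing edge.\<close>
    case (terminal s x y)
    then have xy: "E x y" using adj by (auto elim: adj_terminal_cases)
    obtain z where z: "terminal s y x = g z"
      using bij_is_surj[OF Aut_bij[OF g]] by (rule surjE)
    have "adj (g (MV u m)) (g z)" using xy by (simp add: terminal z[symmetric])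
    then obtain w where "z = terminal ((u, w) \<in> m) u w" "E u w" by (auto elim: adj_MV_cases)
    then have "owner (g z) = owner (g (MV u m))" using owner_image_eq[OF u m] by simp
    then show ?thesis using edgeD(3)[OF xy] by (simp add: terminal z[symmetric])
  next
    case (middle u' m')
    then have m': "m' \<in> even_subsets G u'" using adj by (auto elim: adj_MV_cases)
    have "degree G u' = degree (Y G) (g (MV u m))" by (simp add: middle degree_MV[OF m'])
    also have "\<dots> = degree G u" by (simp add: degree_Aut[OF simple_graph_Y g] degree_MV[OF m])
    finally show ?thesis using that middle m' u by simp
  qed
qed

lemma owner_image_terminals:
  assumes u: "3 \<le> degree G u" and i: "E u i"
  shows "owner (g (AV u i)) = owner (g (BV u i))"
proof -
  obtain j k where j: "E u j" "j \<noteq> i" and k: "E u k" "k \<noteq> i" "k \<noteq> j"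
    using obtain_two_more_neighbours[OF u, of i] by blast
  let ?m = "{(u, i), (u, j)}"
  have m: "?m \<in> even_subsets G u" using i j by (simp add: doubleton_in_even_subsets)
  have "owner (g (AV u i)) = owner (g (MV u ?m))"
    using owner_image_eq[OF u m i] by (simp add: AV_eq_terminal)
  also have "\<dots> = owner (g (BV u k))"
    using owner_image_eq[OF u m k(1)] k by (simp add: BV_eq_terminal)
  also have "\<dots> = owner (g (MV u {}))"
    using owner_image_eq[OF u empty_in_even_subsets k(1)] by (simp add: BV_eq_terminal)
  also have "\<dots> = owner (g (BV u i))"
    using owner_image_eq[OF u empty_in_even_subsets i] by (simp add: BV_eq_terminal)
  finally show ?thesis .
qed

lemma image_terminal_if_degree_ge_3:
  assumes u: "3 \<le> degree G u" and i: "E u i"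
  obtains u' i' where "3 \<le> degree G u'" "E u' i'" "g (terminal s u i) \<in> terminals u' i'"
proof -
  obtain j where "E u j" "j \<noteq> i"
    using obtain_neighbour_outside[of "{i}" G u] u by auto
  then obtain m where m: "m \<in> even_subsets G u" "((u, i) \<in> m) = s"
    using even_subset_with_value[OF i] by metis
  obtain u' m' where m': "g (MV u m) = MV u' m'" "3 \<le> degree G u'"
    using image_middle[OF u m(1)] by metis
  have "adj (g (MV u m)) (g (terminal s u i))" using m i by simp
  then obtain i' where "E u' i'" "g (terminal s u i) \<in> terminals u' i'"
    unfolding m'(1) by (elim adj_MV_cases) auto
  with m'(2) show ?thesis by (rule that)
qed

lemma image_terminals_if_degree_ge_3:
  assumes u: "3 \<le> degree G u" and i: "E u i"
  obtains u' i' where "3 \<le> degree G u'" "E u' i'" "g ` terminals u i = terminals u' i'"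
proof -
  obtain u' p where p: "3 \<le> degree G u'" "E u' p" "g (AV u i) \<in> terminals u' p"
    unfolding AV_eq_terminal using image_terminal_if_degree_ge_3[OF assms] .
  obtain u'' q where q: "E u'' q" "g (BV u i) \<in> terminals u'' q"
    unfolding BV_eq_terminal using image_terminal_if_degree_ge_3[OF assms] .
  have same_owner: "u'' = u'"
    using owner_image_terminals[OF assms] p(3) q(2) by (auto simp: mem_terminals_iff)
  have "card {p, q} < degree G u'" using p(1) by (simp add: card_insert_if)
  then obtain r where "E u' r" "r \<noteq> p" "r \<noteq> q"
    using obtain_neighbour_outside[of "{p, q}" G u'] by auto
  then have "g ` terminals u i = terminals u' p"
    using image_terminals_eqI[OF p(3) q(2)[unfolded same_owner] p(2) q(1)[unfolded same_owner]]
    by blast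
  with p(1,2) show ?thesis by (rule that)
qed

lemma image_opposite_terminals_if_degree_ge_3:
  assumes u: "3 \<le> degree G u" "E u i" and u': "3 \<le> degree G u'" "E u' i'"
    and image: "g ` terminals u i = terminals u' i'"
  shows "g ` terminals i u = terminals i' u'"
proof (rule card_subset_eq)
  show "g ` terminals i u \<subseteq> terminals i' u'"
  proof
    fix y assume "y \<in> g ` terminals i u"
    then obtain s where s: "y = g (terminal s i u)" by (auto simp: mem_terminals_iff)
    have "g (terminal s u i) \<in> terminals u' i'" by (simp flip: image)
    then obtain t where t: "g (terminal s u i) = terminal t u' i'"
      by (auto simp: mem_terminals_iff)
    have not_on_hexagon: "\<not> on_hexagon (Y G) (terminal t u' i') y"
      unfolding s t[symmetric]
      using owner_eq_if_on_hexagon[of "terminal s u i" "terminal s i u"] edgeD(3)[OF u(2)]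
      by auto
    have "adj (terminal t u' i') y" unfolding s t[symmetric] using u(2) by simp
    then show "y \<in> terminals i' u'"
    proof (cases rule: adj_terminal_cases)
      case (middle m)
      then show ?thesis using not_on_hexagon on_hexagon_terminal_MV[OF u'(1), of m i'] by simp
    qed simp
  qed
next
  show "card (g ` terminals i u) = card (terminals i' u')"
    by (simp add: terminals_def)
qed (simp add: terminals_def)

lemma maps_gadget_if_degree_ge_3:
  assumes u: "3 \<le> degree G u"
  obtains u' where "maps_gadget G g u u'"
proof -
  obtain i where i: "E u i" using obtain_neighbour_outside[of "{}" G u] u by auto
  obtain u' i' where u': "3 \<le> degree G u'" "E u' i'" "g ` terminals u i = terminals u' i'"
    using image_terminals_if_degree_ge_3[OF u i] .
  have "g ` terminals i u = terminals i' u'"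
    by (rule image_opposite_terminals_if_degree_ge_3[OF u i u'])
  with i u'(2,3) have "maps_gadget G g u u'" by (rule maps_gadgetI)
  then show ?thesis by (rule that)
qed

subsection \<open>The induced automorphism of \<open>G\<close>\<close>

lemma maps_gadget_unique:
  assumes "maps_gadget G g u u'" "maps_gadget G g u u''" shows "u' = u''"
  using assms by (simp add: maps_gadget_def)

lemma maps_gadget_inj:
  assumes "maps_gadget G g u u'" "maps_gadget G g v u'" shows "u = v"
  using assms by (metis maps_gadget_def inj_image_eq_iff[OF Aut_inj[OF g]] M_verts_eq_iff)

lemma maps_gadget_in_verts:
  assumes "maps_gadget G g u u'" "u \<in> verts G" shows "u' \<in> verts G"
proof -
  have "MV u' {} \<in> g ` M_verts G u" using assms(1) by (simp add: maps_gadget_def M_verts_def)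
  also have "\<dots> \<subseteq> verts (Y G)"
    using assms(2) by (auto simp: M_verts_def Aut_in_verts_iff[OF g])
  finally show ?thesis by simp
qed

lemma maps_gadget_total:
  assumes "connected_graph G" "u \<in> verts G" "3 \<le> degree G u" "v \<in> verts G"
  shows "\<exists>v'. maps_gadget G g v v'"
proof -
  have "(u, v) \<in> {(x, y). E x y}\<^sup>*"
    using assms by (simp add: connected_graph_def)
  then show ?thesis
  proof induction
    case base
    show ?case by (rule maps_gadget_if_degree_ge_3[OF assms(3)]) blast
  next
    case (step x y)
    then show ?case by (auto elim: maps_gadget_neighbour)
  qed
qed

lemma obtain_lies_over:
  assumes total: "\<And>v. v \<in> verts G \<Longrightarrow> \<exists>v'. maps_gadget G g v v'"
  obtains \<sigma> where "\<sigma> \<in> Aut G" "lies_over G g \<sigma>"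
proof -
  define \<sigma> where "\<sigma> v = (if v \<in> verts G then SOME v'. maps_gadget G g v v' else v)" for v
  have \<sigma>: "maps_gadget G g v (\<sigma> v)" if "v \<in> verts G" for v
    using someI_ex[OF total[OF that]] that by (simp add: \<sigma>_def)
  have edge: "E (\<sigma> v) (\<sigma> w) \<and> g ` terminals v w = terminals (\<sigma> v) (\<sigma> w)"
    if vw: "E v w" for v w
  proof -
    obtain w' where w': "E (\<sigma> v) w'" "g ` terminals v w = terminals (\<sigma> v) w'"
      "maps_gadget G g w w'"
      using maps_gadget_neighbour[OF \<sigma>[OF edgeD(1)[OF vw]] vw] .
    have "w' = \<sigma> w" by (rule maps_gadget_unique[OF w'(3) \<sigma>[OF edgeD(2)[OF vw]]])
    with w' show ?thesis by simp
  qed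
  have "\<sigma> \<in> Aut G"
  proof (rule AutI_injective_endomorphism[OF simple])
    show "\<sigma> ` verts G \<subseteq> verts G" using \<sigma> maps_gadget_in_verts by blast
    show "inj_on \<sigma> (verts G)" using \<sigma> maps_gadget_inj by (metis inj_onI)
  qed (use edge in \<open>simp_all add: \<sigma>_def\<close>)
  moreover have "lies_over G g \<sigma>"
    using \<sigma> edge by (simp add: lies_over_def maps_gadget_def)
  ultimately show ?thesis by (rule that)
qed

lemma eq_id_if_fixes_terminals:
  assumes nonisolated: "\<And>u. u \<in> verts G \<Longrightarrow> \<exists>v. E u v"
    and fixed: "\<And>s u v. E u v \<Longrightarrow> g (terminal s u v) = terminal s u v"
  shows "g = id"
proof
  fix x
  show "g x = id x"
  proof (cases "x \<in> verts (Y G)")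
    case True
    then show ?thesis
    proof (cases rule: Y_vertex_cases)
      case (middle u m)
      have "g x \<noteq> terminal s a b" if "E a b" for s a b
        by (metis fixed[OF that] g_eq_iff middle(1) terminal_neq_MV(2))
      moreover have "g x \<in> verts (Y G)" using True by (simp add: Aut_in_verts_iff[OF g])
      ultimately obtain u' n where n: "g x = MV u' n" "n \<in> even_subsets G u'"
        by (metis Y_vertex_cases)
      have same_membership: "u' = u \<and> ((u, w) \<in> n \<longleftrightarrow> (u, w) \<in> m)" if w: "E u w" for w
      proof -
        let ?t = "terminal ((u, w) \<in> m) u w"
        have "adj (g ?t) (g x)" using w middle by simp
        then show ?thesis by (simp add: fixed[OF w] n(1))
      qed
      with nonisolated[OF middle(2)] have "u' = u" by blast
      with n same_membership have "n = m" by (intro even_subsets_eqI[OF _ middle(3)]) simp_all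
      with \<open>u' = u\<close> n(1) middle(1) show ?thesis by simp
    qed (simp add: fixed)
  qed (simp add: permutes_not_in[OF Aut_permutes[OF g]])
qed

end

section \<open>Color-preserving automorphisms\<close>

context gadget_graph
begin

lemma lies_over_comp:
  assumes "lies_over G f \<sigma>" "lies_over G g \<rho>" and \<rho>: "\<rho> \<in> Aut G"
  shows "lies_over G (f \<circ> g) (\<sigma> \<circ> \<rho>)"
  using assms(1,2) Aut_in_verts_iff[OF \<rho>] Aut_edge_iff[OF simple \<rho>]
  unfolding lies_over_def image_comp[symmetric] comp_apply by simp

lemma lies_over_inv:
  assumes g: "lies_over G g \<sigma>" "bij g" and \<sigma>: "\<sigma> \<in> Aut G"
  shows "lies_over G (inv g) (inv \<sigma>)"
proof -
  have \<sigma>_inv: "\<sigma> (inv \<sigma> u) = u" for u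
    by (rule surj_f_inv_f[OF bij_is_surj[OF Aut_bij[OF \<sigma>]]])
  have image_inv: "inv g ` B = A" if "g ` A = B" for A B
    using that bij_is_inj[OF g(2)] by (auto simp: image_inv_f_f)
  have "g ` M_verts G (inv \<sigma> u) = M_verts G u" if "u \<in> verts G" for u
    using g(1) that Aut_in_verts_iff[OF Aut_inv[OF \<sigma>], of u] by (simp add: lies_over_def \<sigma>_inv)
  moreover have "g ` terminals (inv \<sigma> u) (inv \<sigma> v) = terminals u v" if "E u v" for u v
    using g(1) that Aut_edge_iff[OF simple Aut_inv[OF \<sigma>], of u v]
    by (simp add: lies_over_def \<sigma>_inv)
  ultimately show ?thesis by (simp add: lies_over_def image_inv)
qed

lemma lies_over_unique:
  assumes "lies_over G g \<sigma>" "\<sigma> \<in> Aut G" "lies_over G g \<rho>" "\<rho> \<in> Aut G"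
  shows "\<sigma> = \<rho>"
proof
  fix u show "\<sigma> u = \<rho> u"
  proof (cases "u \<in> verts G")
    case True
    then show ?thesis using assms(1,3) by (simp add: lies_over_def)
  next
    case False
    then show ?thesis using assms(2,4) by (simp add: permutes_not_in[OF Aut_permutes])
  qed
qed

lemma same_color_terminal_iff:
  assumes "E u v" shows "same_color G x (terminal s u v) \<longleftrightarrow> x \<in> terminals u v"
proof
  assume "same_color G x (terminal s u v)"
  then show "x \<in> terminals u v"
    by (auto simp: same_color_def terminal_in_gadget M_verts_def AV_eq_terminal BV_eq_terminal
        doubleton_eq_iff)
next
  assume "x \<in> terminals u v"
  then obtain t where x: "x = terminal t u v" by (auto simp: mem_terminals_iff)
  have "x = terminal s u v \<or> {x, terminal s u v} = {AV u v, BV u v}"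
    by (auto simp: x terminal_def)
  then show "same_color G x (terminal s u v)"
    using assms edgeD(1) x terminal_in_gadget unfolding same_color_def by blast
qed

lemma same_color_MV_iff:
  assumes "u \<in> verts G" "m \<in> even_subsets G u"
  shows "same_color G x (MV u m) \<longleftrightarrow> x \<in> M_verts G u"
  using assms by (auto simp: same_color_def MV_in_gadget M_verts_def doubleton_eq_iff)

lemma Aut_X_iff_lies_over_id: "f \<in> Aut_X G \<longleftrightarrow> f \<in> Aut (Y G) \<and> lies_over G f id"
proof (cases "f \<in> Aut (Y G)")
  case f: True
  have image_eq: "f ` S = S" if "f ` S \<subseteq> S" "S \<subseteq> verts (Y G)" for S
    using that Aut_inj[OF f] simple_graph_Y
    by (intro endo_inj_surj) (auto simp: simple_graph_def intro: finite_subset inj_on_subset)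
  have on_terminals: "(\<forall>s. same_color G (f (terminal s u v)) (terminal s u v))
      \<longleftrightarrow> f ` terminals u v = terminals u v" if "E u v" for u v
  proof -
    have "f ` terminals u v \<subseteq> terminals u v \<Longrightarrow> f ` terminals u v = terminals u v"
      by (rule image_eq) (use that in \<open>auto simp: mem_terminals_iff\<close>)
    then show ?thesis using that by (auto simp: same_color_terminal_iff terminals_eq_range)
  qed
  have on_middle: "(\<forall>m\<in>even_subsets G u. same_color G (f (MV u m)) (MV u m))
      \<longleftrightarrow> f ` M_verts G u = M_verts G u" if "u \<in> verts G" for u
  proof -
    have "f ` M_verts G u \<subseteq> M_verts G u \<Longrightarrow> f ` M_verts G u = M_verts G u"
      by (rule image_eq) (use that in \<open>auto simp: M_verts_def\<close>)
    moreover have "f ` M_verts G u \<subseteq> M_verts G u \<longleftrightarrow>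
        (\<forall>m\<in>even_subsets G u. f (MV u m) \<in> M_verts G u)"
      by (auto simp: M_verts_def)
    ultimately show ?thesis using that by (auto simp: same_color_MV_iff)
  qed
  have "(\<forall>x\<in>verts (Y G). same_color G (f x) x) \<longleftrightarrow>
     (\<forall>u v. E u v \<longrightarrow> (\<forall>s. same_color G (f (terminal s u v)) (terminal s u v))) \<and>
     (\<forall>u\<in>verts G. \<forall>m\<in>even_subsets G u. same_color G (f (MV u m)) (MV u m))"
    by (auto elim!: Y_vertex_cases)
  with on_terminals on_middle show ?thesis using f by (auto simp: Aut_X_def lies_over_def)
qed (simp add: Aut_X_def)

section \<open>Lifting automorphisms of \<open>G\<close>\<close>

lemma map_prod_in_even_subsets:
  assumes \<sigma>: "\<sigma> \<in> Aut G" and m: "m \<in> even_subsets G u"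
  shows "map_prod \<sigma> \<sigma> ` m \<in> even_subsets G (\<sigma> u)"
proof -
  have "card (map_prod \<sigma> \<sigma> ` m) = card m"
    using Aut_inj[OF \<sigma>] by (intro card_image inj_on_subset[OF prod.inj_map]) simp_all
  moreover have "map_prod \<sigma> \<sigma> ` m \<subseteq> {(\<sigma> u, v) |v. E (\<sigma> u) v}"
    using even_subsetsD[OF m] Aut_edge_iff[OF simple \<sigma>] by fastforce
  ultimately show ?thesis using m by (simp add: even_subsets_def)
qed

lemma tau_terminal: "E u v \<Longrightarrow> tau G \<sigma> (terminal s u v) = terminal s (\<sigma> u) (\<sigma> v)"
  using terminal_in_Y[of s u v] by (cases s) (simp_all add: tau_def terminal_def)

lemma tau_MV:
  assumes "u \<in> verts G" "m \<in> even_subsets G u"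
  shows "tau G \<sigma> (MV u m) = MV (\<sigma> u) (map_prod \<sigma> \<sigma> ` m)"
proof -
  have "{(\<sigma> u, \<sigma> w) |w. (u, w) \<in> m} = map_prod \<sigma> \<sigma> ` m"
    using assms(2) unfolding even_subsets_def by fastforce
  then show ?thesis using assms by (simp add: tau_def)
qed

lemma adj_tau:
  assumes \<sigma>: "\<sigma> \<in> Aut G" and xy: "adj x y"
  shows "adj (tau G \<sigma> x) (tau G \<sigma> y)"
proof -
  have from_terminal: "adj (tau G \<sigma> (terminal s u v)) (tau G \<sigma> y)"
    if "adj (terminal s u v) y" for s u v y
    using that
  proof (cases rule: adj_terminal_cases)
    case crossing
    then show ?thesis
      using edge_sym by (simp add: tau_terminal Aut_edge_iff[OF simple \<sigma>])
  next
    case (middle m)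
    have "(\<sigma> u, \<sigma> v) \<in> map_prod \<sigma> \<sigma> ` m \<longleftrightarrow> (u, v) \<in> m"
      using Aut_inj[OF \<sigma>] by (auto simp: inj_eq)
    with middle show ?thesis
      using edgeD(1)
      by (simp add: tau_terminal tau_MV Aut_edge_iff[OF simple \<sigma>] map_prod_in_even_subsets[OF \<sigma>])
  qed
  show ?thesis
  proof (cases x rule: yvert_terminal_cases)
    case (terminal s u v)
    with xy from_terminal show ?thesis by simp
  next
    case (middle u m)
    with xy obtain s w where y: "y = terminal s u w" by (auto elim: adj_MV_cases)
    have "adj y x" using xy by (simp only: insert_commute)
    then have "adj (tau G \<sigma> y) (tau G \<sigma> x)" unfolding y by (rule from_terminal)
    then show ?thesis by (simp only: insert_commute)
  qed
qed

lemma tau_in_Aut: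
  assumes \<sigma>: "\<sigma> \<in> Aut G" shows "tau G \<sigma> \<in> Aut (Y G)"
proof (rule AutI_injective_endomorphism[OF simple_graph_Y])
  note \<sigma>_simps = tau_terminal tau_MV Aut_in_verts_iff[OF \<sigma>] Aut_edge_iff[OF simple \<sigma>]
    map_prod_in_even_subsets[OF \<sigma>]
  show "tau G \<sigma> ` verts (Y G) \<subseteq> verts (Y G)"
    by (auto simp: \<sigma>_simps elim!: Y_vertex_cases)
  have "map_prod \<sigma> \<sigma> ` m = map_prod \<sigma> \<sigma> ` n \<longleftrightarrow> m = n" for m n
    using Aut_inj[OF \<sigma>] by (simp add: inj_image_eq_iff prod.inj_map)
  then show "inj_on (tau G \<sigma>) (verts (Y G))"
    by (auto simp: \<sigma>_simps inj_eq[OF Aut_inj[OF \<sigma>]] elim!: Y_vertex_cases intro!: inj_onI)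
qed (use adj_tau[OF \<sigma>] in \<open>simp_all add: tau_def\<close>)

lemma tau_lies_over:
  assumes \<sigma>: "\<sigma> \<in> Aut G" shows "lies_over G (tau G \<sigma>) \<sigma>"
  unfolding lies_over_def
proof (intro conjI ballI allI impI)
  fix u assume u: "u \<in> verts G"
  have "MV (\<sigma> u) n \<in> tau G \<sigma> ` M_verts G u" if n: "n \<in> even_subsets G (\<sigma> u)" for n
  proof -
    let ?m = "map_prod (inv \<sigma>) (inv \<sigma>) ` n"
    have m: "?m \<in> even_subsets G u"
      using map_prod_in_even_subsets[OF Aut_inv[OF \<sigma>] n]
      by (simp add: inv_f_f[OF Aut_inj[OF \<sigma>]])
    have "map_prod \<sigma> \<sigma> ` ?m = n"
      using surj_iff[of \<sigma>] bij_is_surj[OF Aut_bij[OF \<sigma>]]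
      by (simp add: image_comp map_prod.comp map_prod.id)
    then have "MV (\<sigma> u) n = tau G \<sigma> (MV u ?m)" by (simp only: tau_MV[OF u m])
    then show ?thesis using m by (simp add: M_verts_def)
  qed
  then show "tau G \<sigma> ` M_verts G u = M_verts G (\<sigma> u)"
    using u by (auto simp: M_verts_def tau_MV map_prod_in_even_subsets[OF \<sigma>])
next
  fix u v assume "E u v"
  then show "tau G \<sigma> ` terminals u v = terminals (\<sigma> u) (\<sigma> v)"
    by (simp add: terminals_def AV_eq_terminal BV_eq_terminal tau_terminal)
qed

lemma
  assumes "f \<in> Aut_X G" "\<sigma> \<in> Aut G"
  shows Aut_X_comp_tau_in_Aut: "f \<circ> tau G \<sigma> \<in> Aut (Y G)"
    and Aut_X_comp_tau_lies_over: "lies_over G (f \<circ> tau G \<sigma>) \<sigma>"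
  using assms Aut_comp[OF _ tau_in_Aut] lies_over_comp[OF _ tau_lies_over]
  by (fastforce simp: Aut_X_iff_lies_over_id)+

lemma obtain_Aut_X_comp_tau:
  assumes g: "g \<in> Aut (Y G)" "lies_over G g \<sigma>" and \<sigma>: "\<sigma> \<in> Aut G"
  obtains f where "f \<in> Aut_X G" "g = f \<circ> tau G \<sigma>"
proof
  note tau = tau_in_Aut[OF \<sigma>]
  let ?f = "g \<circ> inv (tau G \<sigma>)"
  have "lies_over G ?f (\<sigma> \<circ> inv \<sigma>)"
    by (intro lies_over_comp[OF g(2)] lies_over_inv tau_lies_over Aut_bij[OF tau] Aut_inv \<sigma>)
  moreover have "\<sigma> \<circ> inv \<sigma> = id"
    using bij_is_surj[OF Aut_bij[OF \<sigma>]] by (simp add: surj_iff)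
  ultimately show "?f \<in> Aut_X G"
    using Aut_comp[OF g(1) Aut_inv[OF tau]] by (simp add: Aut_X_iff_lies_over_id)
  show "g = ?f \<circ> tau G \<sigma>"
    by (simp add: comp_assoc inv_o_cancel[OF Aut_inj[OF tau]])
qed

lemma Aut_X_comp_tau_inject:
  assumes "f \<in> Aut_X G" "\<sigma> \<in> Aut G" "f' \<in> Aut_X G" "\<sigma>' \<in> Aut G"
    and eq: "f \<circ> tau G \<sigma> = f' \<circ> tau G \<sigma>'"
  shows "\<sigma> = \<sigma>'" "f = f'"
proof -
  show \<sigma>: "\<sigma> = \<sigma>'"
    using assms Aut_X_comp_tau_lies_over by (metis lies_over_unique)
  show "f = f'"
    using eq bij_is_surj[OF Aut_bij[OF tau_in_Aut[OF assms(2)]]]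
    unfolding \<sigma>[symmetric] by (metis surj_fun_eq)
qed

lemma Aut_Y_eq_iff:
  assumes nonisolated: "\<And>u. u \<in> verts G \<Longrightarrow> \<exists>v. E u v"
    and g: "g \<in> Aut (Y G)" and h: "h \<in> Aut (Y G)"
  shows "g = h \<longleftrightarrow> (\<forall>u v. E u v \<longrightarrow> g (AV u v) = h (AV u v) \<and> g (BV u v) = h (BV u v))"
    (is "_ \<longleftrightarrow> ?agree")
proof
  interpret ratio: gadget_graph_Aut G "inv h \<circ> g"
    by unfold_locales (intro Aut_comp Aut_inv g h)
  assume ?agree
  then have "(inv h \<circ> g) (terminal s u v) = terminal s u v" if "E u v" for s u v
    using that by (simp add: terminal_def inv_f_f[OF Aut_inj[OF h]])
  then have "inv h \<circ> g = id" using ratio.eq_id_if_fixes_terminals nonisolated by blast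
  then have "h \<circ> (inv h \<circ> g) = h" by simp
  then show "g = h"
    using bij_is_surj[OF Aut_bij[OF h]] by (simp add: surj_iff comp_assoc[symmetric])
qed simp

lemma ex1_Aut_X_comp_tau:
  assumes "connected_graph G" "u \<in> verts G" "3 \<le> degree G u" and g: "g \<in> Aut (Y G)"
  shows "\<exists>!(\<sigma>, f). \<sigma> \<in> Aut G \<and> f \<in> Aut_X G \<and> g = f \<circ> tau G \<sigma>"
proof -
  interpret gadget_graph_Aut G g by unfold_locales (rule g)
  obtain \<sigma> where \<sigma>: "\<sigma> \<in> Aut G" "lies_over G g \<sigma>"
    using obtain_lies_over[OF maps_gadget_total[OF assms(1-3)]] .
  obtain f where "f \<in> Aut_X G" "g = f \<circ> tau G \<sigma>"
    using obtain_Aut_X_comp_tau[OF g \<sigma>(2,1)] .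
  with \<sigma> show ?thesis by (intro ex1I[of _ "(\<sigma>, f)"]) (auto dest: Aut_X_comp_tau_inject)
qed

lemma eq_Aut_X_comp_tau_iff:
  assumes "\<And>u. u \<in> verts G \<Longrightarrow> \<exists>v. E u v"
    and "g \<in> Aut (Y G)" "f \<in> Aut_X G" "\<sigma> \<in> Aut G"
  shows "g = f \<circ> tau G \<sigma> \<longleftrightarrow> (\<forall>u v. E u v \<longrightarrow>
      g (AV u v) = f (AV (\<sigma> u) (\<sigma> v)) \<and> g (BV u v) = f (BV (\<sigma> u) (\<sigma> v)))"
  using Aut_Y_eq_iff[OF assms(1,2) Aut_X_comp_tau_in_Aut[OF assms(3,4)]]
  by (simp add: AV_eq_terminal BV_eq_terminal tau_terminal)

end

theorem theorem7p4:
  fixes G :: "'a ugraph"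
  assumes "simple_graph G"
    and "connected_graph G"
    and "card (verts G) \<ge> 2"
    and "max_degree G \<ge> 3"
  shows "(\<forall>g\<in>Aut (Y G).
      \<exists>!(\<sigma>, f). \<sigma> \<in> Aut G \<and> f \<in> Aut_X G \<and>
        (\<forall>u v. {u, v} \<in> edges G \<longrightarrow>
           g (AV u v) = f (AV (\<sigma> u) (\<sigma> v)) \<and>
           g (BV u v) = f (BV (\<sigma> u) (\<sigma> v))))
    \<and> Aut (Y G) = {f \<circ> tau G \<sigma> | f \<sigma>. f \<in> Aut_X G \<and> \<sigma> \<in> Aut G}"
proof (intro conjI ballI)
  interpret gadget_graph G by unfold_locales (rule assms)
  obtain u where u: "u \<in> verts G" "degree G u = max_degree G"
    using obtain_max_degree[OF finite_verts] assms(2) by (auto simp: connected_graph_def)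
  have nonisolated: "\<exists>w. E v w" if "v \<in> verts G" for v
    using connected_graph_obtain_neighbour[OF assms(2,3) that] by blast
  have decomposition: "\<exists>!(\<sigma>, f). \<sigma> \<in> Aut G \<and> f \<in> Aut_X G \<and> g = f \<circ> tau G \<sigma>"
    if "g \<in> Aut (Y G)" for g
    using ex1_Aut_X_comp_tau[OF assms(2) u(1) _ that] u(2) assms(4) by simp
  show "Aut (Y G) = {f \<circ> tau G \<sigma> | f \<sigma>. f \<in> Aut_X G \<and> \<sigma> \<in> Aut G}"
    using decomposition Aut_X_comp_tau_in_Aut by blast
  fix g assume g: "g \<in> Aut (Y G)"
  show "\<exists>!(\<sigma>, f). \<sigma> \<in> Aut G \<and> f \<in> Aut_X G \<and>
      (\<forall>u v. E u v \<longrightarrow>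
         g (AV u v) = f (AV (\<sigma> u) (\<sigma> v)) \<and> g (BV u v) = f (BV (\<sigma> u) (\<sigma> v)))"
    using decomposition[OF g]
    by (simp add: eq_Aut_X_comp_tau_iff[OF nonisolated g] cong: conj_cong)
qed

end
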